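(* Let $f \in \mathbb{Z}[x]$ be monic, quadratic, and irreducible over $\mathbb{Q}$, and write $f = (x - \gamma)^2 + \gamma + m$. Suppose that $|m| > 6 + 3\sqrt{|\gamma| + 1}$ (if $\gamma \in \mathbb{Z}$, it suffices that $|m| > 1 + \sqrt{|\gamma| + 1}$), and that $$\frac{-m \pm \sqrt{f^2(\gamma)}}{2} \notin \mathbb{Q}^{*2}$$ (for both choices of sign). Then $f$ is stable, i.e. $f^n$ is irreducible over $\mathbb{Q}$ for all $n \geq 1$.
   Context: $f^n$ denotes the $n$-th iterate of $f$ under composition. $\mathbb{Q}^{*2}$ denotes the set of squares of nonzero rational numbers. *)

theory Defs
  imports Complex_Main "HOL-Computational_Algebra.Computational_Algebra"
begin

definition poly_iter :: "'a::comm_semiring_1 poly \<Rightarrow> nat \<Rightarrow> 'a poly" where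
  "poly_iter f n = ((\<lambda>g. pcompose f g) ^^ n) [:0, 1:]"

definition stable_poly :: "'a::field poly \<Rightarrow> bool" where
  "stable_poly f \<longleftrightarrow> (\<forall>n\<ge>1. irreducible (poly_iter f n))"

definition nonzero_rat_squares :: "rat set" where
  "nonzero_rat_squares = {q\<^sup>2 | q. q \<noteq> 0}"

end

theory Submission
  imports Defs "HOL-Computational_Algebra.Field_as_Ring"
begin

text \<open>If \<open>F\<^sup>n\<close> is irreducible but \<open>F\<^sup>n\<^sup>+\<^sup>1\<close> is not, then \<open>F\<^sup>n\<^sup>+\<^sup>1(x + \<gamma>) = g(x) g(-x)\<close> for a monic
  rational \<open>g\<close>. For \<open>n = 1\<close>, comparing coefficients contradicts the hypothesis on
  \<open>(-m \<plusminus> \<surd>F\<^sup>2(\<gamma>)) / 2\<close>. For \<open>n \<ge> 2\<close>, putting \<open>x = 0\<close> shows that \<open>F\<^sup>n\<^sup>+\<^sup>1(\<gamma>) = c\<^sup>2 + \<gamma> + m\<close> is a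
  rational square, where \<open>c = F\<^sup>n(\<gamma>) - \<gamma>\<close>. After clearing denominators (powers of \<open>4\<close> if
  \<open>\<gamma>\<close> is a half-integer) this is impossible, because \<open>\<gamma> + m \<noteq> 0\<close> and the lower bound on
  \<open>\<bar>m\<bar>\<close> makes \<open>c\<close> so large that no other square lies within \<open>\<bar>\<gamma> + m\<bar>\<close> of \<open>c\<^sup>2\<close>.\<close>

section \<open>Irreducibility under the substitutions \<open>x + a\<close> and
  \<open>x^2\<close>\<close>

lemma irreducible_pcompose_shift_iff:
  fixes p :: "'a::field poly"
  shows "irreducible (p \<circ>\<^sub>p [:a, 1:]) \<longleftrightarrow> irreducible p"
proof -
  have inv: "(q \<circ>\<^sub>p [:-b, 1:]) \<circ>\<^sub>p [:b, 1:] = q" for q :: "'a poly" and b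
    by (simp add: pcompose_assoc [symmetric] pcompose_pCons)
  have unit: "(q \<circ>\<^sub>p [:b, 1:]) dvd 1 \<longleftrightarrow> q dvd 1" for q :: "'a poly" and b
    by (cases "q = 0")
       (auto simp: is_unit_iff_degree degree_pcompose pcompose_eq_0_iff)
  have shift: "irreducible (q \<circ>\<^sub>p [:b, 1:])" if q: "irreducible q" for q :: "'a poly" and b
  proof (rule irreducibleI)
    show "q \<circ>\<^sub>p [:b, 1:] \<noteq> 0" using q by (auto simp: pcompose_eq_0_iff)
    show "\<not> q \<circ>\<^sub>p [:b, 1:] dvd 1" using q by (simp add: unit irreducible_not_unit)
  next
    fix r s assume "q \<circ>\<^sub>p [:b, 1:] = r * s"
    then have "q = (r \<circ>\<^sub>p [:-b, 1:]) * (s \<circ>\<^sub>p [:-b, 1:])"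
      using inv [of q "-b"] by (simp add: pcompose_mult)
    then show "r dvd 1 \<or> s dvd 1"
      using irreducibleD [OF q] unit by metis
  qed
  show ?thesis
    using shift [of p a] shift [of "p \<circ>\<^sub>p [:a, 1:]" "-a"] inv [of p "-a"] by auto
qed

text \<open>Serves to write \<open>g(x) g(-x)\<close> as \<open>A^2 - x B^2\<close> evaluated at
  \<open>x^2\<close>. Prepending a coefficient exchanges the even and odd parts.\<close>

lemma poly_even_odd_decomposition:
  fixes g :: "'a::comm_ring_1 poly"
  obtains A B where "g = A \<circ>\<^sub>p [:0, 0, 1:] + [:0, 1:] * (B \<circ>\<^sub>p [:0, 0, 1:])"
proof -
  have "\<exists>A B. g = A \<circ>\<^sub>p [:0, 0, 1:] + [:0, 1:] * (B \<circ>\<^sub>p [:0, 0, 1:])"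
  proof (induction g)
    case 0
    show ?case by (intro exI [of _ 0]) simp
  next
    case (pCons a h)
    then obtain A B where "h = A \<circ>\<^sub>p [:0, 0, 1:] + [:0, 1:] * (B \<circ>\<^sub>p [:0, 0, 1:])"
      by blast
    then have "pCons a h = pCons a B \<circ>\<^sub>p [:0, 0, 1:] + [:0, 1:] * (A \<circ>\<^sub>p [:0, 0, 1:])"
      by (simp add: pcompose_pCons)
    then show ?case by blast
  qed
  then show ?thesis using that by blast
qed

text \<open>If \<open>g\<close> divides \<open>p(x\<^sup>2)\<close> and \<open>g(x) g(-x) = q(x\<^sup>2)\<close>, then \<open>p\<close> and \<open>q\<close> cannot be
  coprime: a Bezout identity, evaluated at \<open>x\<^sup>2\<close>, would make \<open>g\<close> a unit.\<close>

lemma reducible_pcompose_square: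
  fixes p :: "rat poly"
  assumes irr: "irreducible p" and monic: "lead_coeff p = 1" and even: "even (degree p)"
    and red: "\<not> irreducible (p \<circ>\<^sub>p [:0, 0, 1:])"
  obtains g where "lead_coeff g = 1" "degree g = degree p"
    "p \<circ>\<^sub>p [:0, 0, 1:] = g * (g \<circ>\<^sub>p [:0, -1:])"
proof -
  let ?P = "p \<circ>\<^sub>p [:0, 0, 1:]"
  have p0: "p \<noteq> 0" using irr by auto
  have degp: "degree p > 0" using irr p0 is_unit_iff_degree irreducible_not_unit by blast
  have P0: "?P \<noteq> 0" using p0 by (simp add: pcompose_eq_0_iff)
  have degP: "degree ?P = 2 * degree p" by (simp add: degree_pcompose)
  have leadP: "lead_coeff ?P = 1"
    using monic by (simp add: lead_coeff_comp)
  have "\<not> ?P dvd 1" using P0 degP degp by (simp add: is_unit_iff_degree)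
  with red P0 obtain a b where ab: "?P = a * b" "\<not> a dvd 1" "\<not> b dvd 1"
    by (auto simp: irreducible_def)
  have "a \<noteq> 0" "b \<noteq> 0" using ab P0 by auto
  then have "degree a + degree b = 2 * degree p"
    using degP ab(1) by (simp add: degree_mult_eq)
  then have "degree a \<le> degree p \<or> degree b \<le> degree p" by linarith
  then obtain g where g: "g dvd ?P" "\<not> g dvd 1" "degree g \<le> degree p"
    using ab by (metis dvd_triv_left dvd_triv_right)
  have g0: "g \<noteq> 0" using g(1) P0 by auto
  obtain A B where AB: "g = A \<circ>\<^sub>p [:0, 0, 1:] + [:0, 1:] * (B \<circ>\<^sub>p [:0, 0, 1:])"
    by (rule poly_even_odd_decomposition)
  define h where "h = g \<circ>\<^sub>p [:0, -1:]"
  define q where "q = A\<^sup>2 - [:0, 1:] * B\<^sup>2"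
  have h: "h = A \<circ>\<^sub>p [:0, 0, 1:] - [:0, 1:] * (B \<circ>\<^sub>p [:0, 0, 1:])"
    unfolding h_def AB
    by (simp add: pcompose_add pcompose_mult pcompose_pCons pcompose_assoc [symmetric])
  have qgh: "q \<circ>\<^sub>p [:0, 0, 1:] = g * h"
    unfolding h AB q_def
    by (simp add: power2_eq_square pcompose_diff pcompose_mult pcompose_pCons algebra_simps)
  have h0: "h \<noteq> 0" using g0 by (simp add: h_def pcompose_eq_0_iff)
  have degh: "degree h = degree g" by (simp add: h_def degree_pcompose)
  have "degree (q \<circ>\<^sub>p [:0, 0, 1:]) = 2 * degree g"
    using qgh g0 h0 degh by (simp add: degree_mult_eq)
  then have degq: "degree q = degree g" by (simp add: degree_pcompose)
  have q0: "q \<noteq> 0" using qgh g0 h0 by auto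
  \<comment> \<open>As \<open>q\<close> has the degree of \<open>g\<close>, which is at most that of
    \<open>p\<close>, divisibility will force \<open>q\<close> to be a constant multiple of
    \<open>p\<close>.\<close>
  have "p dvd q"
  proof (rule ccontr)
    assume "\<not> p dvd q"
    then have "coprime p q"
      using irreducibleD' [OF irr, of "gcd p q"] by (auto simp: is_unit_gcd)
    then obtain u v where "u * p + v * q = 1"
      by (metis bezout_coefficients_fst_snd coprime_imp_gcd_eq_1)
    then have "(u \<circ>\<^sub>p [:0, 0, 1:]) * ?P + (v \<circ>\<^sub>p [:0, 0, 1:]) * (q \<circ>\<^sub>p [:0, 0, 1:]) = 1"
      by (metis pcompose_1 pcompose_add pcompose_mult)
    moreover have "g dvd (u \<circ>\<^sub>p [:0, 0, 1:]) * ?P + (v \<circ>\<^sub>p [:0, 0, 1:]) * (q \<circ>\<^sub>p [:0, 0, 1:])"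
      using g(1) qgh by simp
    ultimately show False using g(2) by simp
  qed
  then obtain r where r: "q = p * r" by blast
  have "r \<noteq> 0" using r q0 by auto
  then have "degree q = degree p + degree r" using r p0 by (simp add: degree_mult_eq)
  then have deg: "degree g = degree p" and "degree r = 0" using degq g(3) by auto
  then obtain u where "r = [:u:]" by (metis degree_eq_zeroE)
  then have "q = smult u p" using r by simp
  then have uP: "smult u ?P = g * h" using qgh by (simp add: pcompose_smult)
  define l where "l = lead_coeff g"
  have l0: "l \<noteq> 0" using g0 by (simp add: l_def)
  \<comment> \<open>Even degree gives \<open>g(-x)\<close> the leading coefficient of
    \<open>g\<close>, so \<open>u\<close> is the square of \<open>l\<close>, and dividing both
    factors by \<open>l\<close> makes them monic.\<close>
  have "lead_coeff h = l"
    using even deg by (simp add: h_def lead_coeff_comp l_def)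
  then have "lead_coeff (smult u ?P) = l * l"
    by (simp only: uP lead_coeff_mult l_def)
  then have "u = l * l" by (simp only: lead_coeff_smult leadP mult_1_right)
  then have "smult (1 / (l * l)) (smult (l * l) ?P) = smult (1 / (l * l)) (g * h)"
    using uP by simp
  then have "?P = smult (1 / l) g * smult (1 / l) h"
    using l0 by simp
  moreover have "smult (1 / l) h = smult (1 / l) g \<circ>\<^sub>p [:0, -1:]"
    by (simp add: h_def pcompose_smult)
  ultimately have "?P = smult (1 / l) g * (smult (1 / l) g \<circ>\<^sub>p [:0, -1:])" by (simp only:)
  moreover have "lead_coeff (smult (1 / l) g) = 1" "degree (smult (1 / l) g) = degree p"
    using deg l0 by (simp_all add: l_def)
  ultimately show ?thesis using that by blast
qed

section \<open>Iterates of a polynomial\<close>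

lemma poly_iter_Suc: "poly_iter f (Suc n) = f \<circ>\<^sub>p poly_iter f n"
  by (simp add: poly_iter_def)

lemma poly_iter_0 [simp]: "poly_iter f 0 = [:0, 1:]"
  by (simp add: poly_iter_def)

lemma poly_iter_1: "poly_iter f (Suc 0) = f"
  by (simp add: poly_iter_def)

lemma poly_iter_Suc_right:
  fixes f :: "'a::comm_ring_1 poly"
  shows "poly_iter f (Suc n) = poly_iter f n \<circ>\<^sub>p f"
proof (induction n)
  case 0
  then show ?case by (simp add: poly_iter_Suc pcompose_pCons)
next
  case (Suc n)
  then show ?case by (metis pcompose_assoc poly_iter_Suc)
qed

lemma degree_poly_iter:
  fixes f :: "'a::idom poly"
  shows "degree (poly_iter f n) = degree f ^ n"
  by (induction n) (simp_all add: poly_iter_Suc degree_pcompose)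

lemma lead_coeff_poly_iter:
  fixes f :: "'a::idom poly"
  assumes "lead_coeff f = 1" "degree f > 0"
  shows "lead_coeff (poly_iter f n) = 1"
proof (induction n)
  case (Suc n)
  then show ?case using assms
    by (simp add: poly_iter_Suc lead_coeff_comp degree_poly_iter)
qed simp

section \<open>Integrality of rational square roots and gaps between squares\<close>

lemma rat_square_in_Ints:
  fixes s :: rat
  assumes "s\<^sup>2 \<in> \<int>"
  shows "s \<in> \<int>"
proof (rule rational_algebraic_int_is_int)
  show "algebraic_int s"
    \<comment> \<open>The witness is the monic polynomial \<open>x^2 - s^2\<close>, which has
      integer coefficients.\<close>
    by (rule algebraic_int.intros [of "[:-(s\<^sup>2), 0, 1:]"])
       (use assms in \<open>auto simp: coeff_pCons power2_eq_square split: nat.splits\<close>)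
  show "s \<in> \<rat>"
    by (cases s) (simp add: Fract_of_int_quotient)
qed

text \<open>Clearing denominators turns \<open>s\<^sup>2\<close> and \<open>x\<^sup>2\<close> into distinct integer squares, which
  differ by at least \<open>2 \<bar>E x\<bar> - 1\<close>.\<close>

lemma rat_square_gap:
  fixes x t s E :: rat
  assumes E: "E > 0" and x: "E * x \<in> \<int>" and t: "E\<^sup>2 * t \<in> \<int>" "t \<noteq> 0"
    and s: "x\<^sup>2 + t = s\<^sup>2"
  shows "2 * \<bar>x\<bar> \<le> E * \<bar>t\<bar> + 1 / E"
proof -
  have eq: "(E * s)\<^sup>2 = (E * x)\<^sup>2 + E\<^sup>2 * t"
    using s by (simp add: power_mult_distrib flip: distrib_left)
  then have "(E * s)\<^sup>2 \<in> \<int>" using x t by simp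
  then have "E * s \<in> \<int>" by (rule rat_square_in_Ints)
  then obtain S where S: "E * s = of_int S" by (auto elim: Ints_cases)
  obtain X where X: "E * x = of_int X" using x by (auto elim: Ints_cases)
  obtain T where T: "E\<^sup>2 * t = of_int T" using t by (auto elim: Ints_cases)
  have "(of_int (S\<^sup>2) :: rat) = of_int (X\<^sup>2 + T)" using eq unfolding S X T by simp
  then have ST: "\<bar>S\<bar>\<^sup>2 = \<bar>X\<bar>\<^sup>2 + T" by (simp only: of_int_eq_iff power2_abs)
  have "E\<^sup>2 * t \<noteq> 0" using t E by simp
  then have "T \<noteq> 0" unfolding T by simp
  then have "\<bar>S\<bar> \<noteq> \<bar>X\<bar>" using ST by force
  then consider "\<bar>S\<bar> \<ge> \<bar>X\<bar> + 1" | "\<bar>S\<bar> + 1 \<le> \<bar>X\<bar>" by linarith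
  then have "2 * \<bar>X\<bar> \<le> \<bar>T\<bar> + 1"
  proof cases
    case 1
    then have "(\<bar>X\<bar> + 1)\<^sup>2 \<le> \<bar>S\<bar>\<^sup>2" by (intro power_mono) auto
    then show ?thesis using ST by (simp add: power2_sum)
  next
    case 2
    then have "\<bar>S\<bar>\<^sup>2 \<le> (\<bar>X\<bar> - 1)\<^sup>2" by (intro power_mono) auto
    then show ?thesis using ST by (simp add: power2_diff)
  qed
  then have "(of_int (2 * \<bar>X\<bar>) :: rat) \<le> of_int (\<bar>T\<bar> + 1)" by (simp only: of_int_le_iff)
  then have "2 * \<bar>E * x\<bar> \<le> \<bar>E\<^sup>2 * t\<bar> + 1" unfolding X T by simp
  then have "E * (2 * \<bar>x\<bar>) \<le> E * (E * \<bar>t\<bar> + 1 / E)"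
    using E by (simp add: abs_mult power2_eq_square algebra_simps)
  then show ?thesis using E by (simp only: mult_le_cancel_left_pos)
qed

section \<open>Denominators and growth of the critical orbit\<close>

text \<open>In the coordinate \<open>x - \<gamma>\<close> the polynomial is \<open>x\<^sup>2 + m\<close>, and \<open>crit_orbit m k\<close> is its
  \<open>(k+1)\<close>-st iterate at the critical point \<open>0\<close>.\<close>

fun crit_orbit :: "rat \<Rightarrow> nat \<Rightarrow> rat" where
  "crit_orbit m 0 = m"
| "crit_orbit m (Suc k) = (crit_orbit m k)\<^sup>2 + m"

text \<open>Squaring doubles the exponent of \<open>D\<close>; one factor \<open>D\<close> of the
  new power clears the denominator of the added \<open>m\<close>.\<close>

lemma crit_orbit_denominator:
  assumes "D \<in> \<int>" "D * m \<in> \<int>"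
  shows "D ^ 2 ^ k * crit_orbit m k \<in> \<int>"
proof (induction k)
  case (Suc k)
  obtain j where "2 ^ Suc k = Suc j" by (metis not0_implies_Suc power_not_zero zero_neq_numeral)
  then have "D ^ 2 ^ Suc k * m = D ^ j * (D * m)" by simp
  then have "D ^ 2 ^ Suc k * m \<in> \<int>" using assms by (metis Ints_mult Ints_power)
  moreover have "D ^ 2 ^ Suc k * (crit_orbit m k)\<^sup>2 = (D ^ 2 ^ k * crit_orbit m k)\<^sup>2"
    by (simp add: power_mult_distrib power_mult [symmetric] mult.commute)
  ultimately show ?case using Suc
    by (simp only: crit_orbit.simps distrib_left) (intro Ints_add Ints_power)
qed (use assms in simp)

text \<open>The orbit outgrows its denominators by a factor \<open>E\<close>. The condition on
  \<open>E * D\<^sup>2\<close> starts the induction; in the step,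
  \<open>\<bar>m\<bar> \<le> E * (E - 1)\<close> ensures that squaring gains more than adding
  \<open>m\<close> can lose.\<close>

lemma crit_orbit_growth:
  assumes D: "D \<ge> 1" and E: "E \<ge> 1" "E * D\<^sup>2 \<le> \<bar>m\<bar> * (\<bar>m\<bar> - 1)" "\<bar>m\<bar> \<le> E * (E - 1)"
  shows "E * D ^ 2 ^ Suc k \<le> \<bar>crit_orbit m (Suc k)\<bar>"
proof (induction k)
  case 0
  have "\<bar>m\<bar> * (\<bar>m\<bar> - 1) \<le> \<bar>m\<^sup>2 + m\<bar>"
    by (simp add: power2_eq_square algebra_simps abs_if)
  then show ?case using E by simp
next
  case (Suc k)
  let ?P = "D ^ 2 ^ Suc k" and ?c = "crit_orbit m (Suc k)"
  have P: "1 \<le> ?P\<^sup>2" using D by (intro one_le_power) auto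
  have "E * ?P\<^sup>2 \<le> (E\<^sup>2 - \<bar>m\<bar>) * ?P\<^sup>2"
    using E P by (intro mult_right_mono) (auto simp: power2_eq_square algebra_simps)
  also have "\<dots> \<le> E\<^sup>2 * ?P\<^sup>2 - \<bar>m\<bar>"
    using mult_left_mono [OF P, of "\<bar>m\<bar>"] by (simp add: left_diff_distrib)
  also have "E\<^sup>2 * ?P\<^sup>2 \<le> ?c\<^sup>2"
    using power_mono [OF Suc.IH, of 2] D E by (simp add: power_mult_distrib)
  finally have "E * ?P\<^sup>2 \<le> ?c\<^sup>2 + m" by linarith
  moreover have "?P\<^sup>2 = D ^ 2 ^ Suc (Suc k)"
    by (simp add: power_mult [symmetric] mult.commute)
  ultimately have "E * D ^ 2 ^ Suc (Suc k) \<le> crit_orbit m (Suc (Suc k))" by simp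
  then show ?case by linarith
qed

text \<open>A square would, by \<open>rat_square_gap\<close> with scaling factor \<open>?P\<close>,
  bound \<open>2 * \<bar>?c\<bar>\<close> by
  \<open>?P * (\<bar>\<gamma> + m\<bar> + 1 / D\<^sup>2)\<close>, while growth gives at least
  \<open>2 * E * ?P\<close>.\<close>

lemma crit_orbit_not_square:
  fixes m \<gamma> s D E :: rat
  assumes "D \<in> \<int>" "D \<ge> 1" "D * m \<in> \<int>" "D * (\<gamma> + m) \<in> \<int>" "\<gamma> + m \<noteq> 0"
    and E: "E \<ge> 1" "E * D\<^sup>2 \<le> \<bar>m\<bar> * (\<bar>m\<bar> - 1)" "\<bar>m\<bar> \<le> E * (E - 1)" "\<bar>\<gamma> + m\<bar> + 1 / D\<^sup>2 < 2 * E"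
  shows "(crit_orbit m (Suc k))\<^sup>2 + (\<gamma> + m) \<noteq> s\<^sup>2"
proof
  let ?P = "D ^ 2 ^ Suc k" and ?c = "crit_orbit m (Suc k)"
  assume s: "?c\<^sup>2 + (\<gamma> + m) = s\<^sup>2"
  have PD: "D \<le> ?P" using power_increasing [of 1 "2 ^ Suc k" D] assms by simp
  with assms have P1: "1 \<le> ?P" by linarith
  obtain j where "2 ^ Suc k * 2 = Suc j"
    by (metis not0_implies_Suc power_not_zero power_Suc2 zero_neq_numeral)
  then have "?P\<^sup>2 = D ^ j * D" by (metis power_Suc2 power_mult)
  then have "?P\<^sup>2 * (\<gamma> + m) \<in> \<int>" using assms by (simp add: mult.assoc)
  then have "2 * \<bar>?c\<bar> \<le> ?P * \<bar>\<gamma> + m\<bar> + 1 / ?P"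
    using P1 assms by (intro rat_square_gap [OF _ crit_orbit_denominator _ _ s]) auto
  also have "1 / ?P \<le> ?P / D\<^sup>2"
    using power_mono [OF PD, of 2] assms P1 by (simp add: field_simps power2_eq_square)
  also have "?P * \<bar>\<gamma> + m\<bar> + ?P / D\<^sup>2 = ?P * (\<bar>\<gamma> + m\<bar> + 1 / D\<^sup>2)"
    by (simp add: algebra_simps)
  also have "\<dots> < ?P * (2 * E)" using E(4) P1 by (intro mult_strict_left_mono) auto
  finally have "\<bar>?c\<bar> < E * ?P" by (simp add: mult.commute)
  then show False using crit_orbit_growth [OF assms(2) E(1-3), of k] by linarith
qed


section \<open>The quadratic in vertex form and its iterates\<close>

locale vertex_form =
  fixes F :: "rat poly" and \<gamma> m :: rat
  assumes F: "F = [:-\<gamma>, 1:]\<^sup>2 + [:\<gamma> + m:]"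
begin

lemma F_coeffs: "F = [:\<gamma>\<^sup>2 + \<gamma> + m, - 2 * \<gamma>, 1:]"
  by (simp add: F power2_eq_square)

lemma degree_F: "degree F = 2" and lead_coeff_F: "lead_coeff F = 1"
  by (simp_all add: F_coeffs)

lemma poly_iter_vertex: "poly (poly_iter F (Suc k)) \<gamma> = crit_orbit m k + \<gamma>"
proof (induction k)
  case 0
  show ?case by (simp add: poly_iter_1 F)
next
  case (Suc k)
  show ?case
    by (subst poly_iter_Suc) (simp only: poly_pcompose Suc, simp add: F)
qed

text \<open>Otherwise \<open>F\<close> is the square of a linear factor. This keeps the two squares
  in the gap argument distinct.\<close>

lemma vertex_value_nonzero:
  assumes "irreducible F"
  shows "\<gamma> + m \<noteq> 0"
proof
  assume "\<gamma> + m = 0"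
  then have "F = [:-\<gamma>, 1:] * [:-\<gamma>, 1:]" by (simp add: F power2_eq_square)
  then show False
    using irreducibleD [OF assms, of "[:-\<gamma>, 1:]" "[:-\<gamma>, 1:]"] by (simp add: is_unit_iff_degree)
qed

text \<open>Since \<open>F(x + \<gamma>) = x^2 + \<gamma> + m\<close>, the shifted next iterate is
  \<open>p(x^2)\<close>, where \<open>p\<close> is a shift of the irreducible current iterate; its
  degree \<open>2 ^ n\<close> is even because \<open>n \<ge> 1\<close>.\<close>

lemma reducible_iterate:
  assumes "n \<ge> 1" "irreducible (poly_iter F n)" "\<not> irreducible (poly_iter F (Suc n))"
  obtains g where "lead_coeff g = 1" "degree g = 2 ^ n"
    "poly_iter F (Suc n) \<circ>\<^sub>p [:\<gamma>, 1:] = g * (g \<circ>\<^sub>p [:0, -1:])"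
proof -
  define p where "p = poly_iter F n \<circ>\<^sub>p [:\<gamma> + m, 1:]"
  have "F \<circ>\<^sub>p [:\<gamma>, 1:] = [:\<gamma> + m, 1:] \<circ>\<^sub>p [:0, 0, 1:]"
    by (simp add: F power2_eq_square pcompose_add pcompose_mult pcompose_pCons)
  then have eq: "p \<circ>\<^sub>p [:0, 0, 1:] = poly_iter F (Suc n) \<circ>\<^sub>p [:\<gamma>, 1:]"
    unfolding p_def poly_iter_Suc_right by (metis pcompose_assoc)
  have deg: "degree p = 2 ^ n"
    by (simp add: p_def degree_pcompose degree_poly_iter degree_F)
  have irr: "irreducible p" using assms by (simp add: p_def irreducible_pcompose_shift_iff)
  have red: "\<not> irreducible (p \<circ>\<^sub>p [:0, 0, 1:])"
    using assms by (simp add: eq irreducible_pcompose_shift_iff)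
  have "lead_coeff (poly_iter F n) = 1"
    using lead_coeff_poly_iter [of F n] degree_F lead_coeff_F by simp
  then have monic: "lead_coeff p = 1" by (simp add: p_def lead_coeff_comp)
  have "even (degree p)" using deg assms by simp
  from reducible_pcompose_square [OF irr monic this red] show ?thesis
    using that by (metis deg eq)
qed

lemma reducible_iterate_vertex_square:
  assumes "n \<ge> 1" "irreducible (poly_iter F n)" "\<not> irreducible (poly_iter F (Suc n))"
  obtains s where "poly (poly_iter F (Suc n)) \<gamma> = s\<^sup>2"
proof -
  from reducible_iterate [OF assms] obtain g where
    g: "poly_iter F (Suc n) \<circ>\<^sub>p [:\<gamma>, 1:] = g * (g \<circ>\<^sub>p [:0, -1:])" by metis
  have "poly (poly_iter F (Suc n)) \<gamma> = (poly g 0)\<^sup>2"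
    using arg_cong [OF g, of "\<lambda>q. poly q 0"] by (simp add: poly_pcompose power2_eq_square)
  then show ?thesis by (rule that)
qed

text \<open>With \<open>g = x^2 + a x + b\<close>, comparing coefficients gives \<open>b^2\<close>
  as the value of the second iterate at \<gamma>, and
  \<open>(b - m) / 2 = (a / 2)^2\<close>.\<close>

lemma irreducible_second_iterate:
  assumes irr: "irreducible F"
    and plus: "(- real_of_rat m + sqrt (real_of_rat (poly (poly_iter F 2) \<gamma>))) / 2
           \<notin> real_of_rat ` nonzero_rat_squares"
    and minus: "(- real_of_rat m - sqrt (real_of_rat (poly (poly_iter F 2) \<gamma>))) / 2
           \<notin> real_of_rat ` nonzero_rat_squares"
  shows "irreducible (poly_iter F 2)"
proof (rule ccontr)
  assume "\<not> irreducible (poly_iter F 2)"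
  then have red: "\<not> irreducible (poly_iter F (Suc 1))" by (simp add: numeral_2_eq_2)
  have "irreducible (poly_iter F 1)" using irr by (simp add: poly_iter_1)
  from reducible_iterate [OF _ this red] obtain g where g: "lead_coeff g = 1" "degree g = 2"
    "poly_iter F (Suc 1) \<circ>\<^sub>p [:\<gamma>, 1:] = g * (g \<circ>\<^sub>p [:0, -1:])" by auto
  define a b where "a = coeff g 1" and "b = coeff g 0"
  have gab: "g = [:b, a, 1:]"
    using g(1,2) by (intro poly_eqI)
      (auto simp: coeff_pCons a_def b_def numeral_2_eq_2 coeff_eq_0 split: nat.splits)
  have expand: "poly_iter F (Suc 1) \<circ>\<^sub>p [:\<gamma>, 1:] = [:m\<^sup>2 + m + \<gamma>, 0, 2 * m, 0, 1:]"
    by (simp add: poly_iter_Suc F pcompose_add pcompose_mult pcompose_pCons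
        power2_eq_square algebra_simps)
  have "g * (g \<circ>\<^sub>p [:0, -1:]) = [:b\<^sup>2, 0, 2 * b - a\<^sup>2, 0, 1:]"
    by (simp add: gab pcompose_pCons power2_eq_square)
  then have b: "m\<^sup>2 + m + \<gamma> = b\<^sup>2" and a: "2 * m = 2 * b - a\<^sup>2"
    using g(3) expand by auto
  have "a \<noteq> 0"
  proof
    assume "a = 0"
    with a b have "\<gamma> + m = 0" by simp
    with vertex_value_nonzero [OF irr] show False by simp
  qed
  moreover have "(b - m) / 2 = (a / 2)\<^sup>2" using a by (simp add: power_divide)
  ultimately have "(b - m) / 2 \<in> nonzero_rat_squares"
    unfolding nonzero_rat_squares_def by (intro CollectI exI [of _ "a / 2"]) simp
  then have mem: "real_of_rat ((b - m) / 2) \<in> real_of_rat ` nonzero_rat_squares" by blast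
  have "poly (poly_iter F 2) \<gamma> = b\<^sup>2"
    using poly_iter_vertex [of 1] b by (simp add: numeral_2_eq_2)
  then have sqrt: "sqrt (real_of_rat (poly (poly_iter F 2) \<gamma>)) = \<bar>real_of_rat b\<bar>"
    by (simp add: of_rat_power)
  have half: "real_of_rat ((b - m) / 2) = (- real_of_rat m + real_of_rat b) / 2"
    by (simp add: of_rat_divide of_rat_diff)
  show False
  \<comment> \<open>The root of \<open>b^2\<close> is the absolute value of \<open>b\<close>, so the
    sign of \<open>b\<close> decides which hypothesis is contradicted.\<close>
  proof (cases "real_of_rat b \<ge> 0")
    case True
    then show False using plus mem unfolding sqrt half by (simp only: abs_of_nonneg simp_thms)
  next
    case False
    then have "- real_of_rat m - \<bar>real_of_rat b\<bar> = - real_of_rat m + real_of_rat b" by linarith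
    then show False using minus mem unfolding sqrt half by (simp only: simp_thms)
  qed
qed

text \<open>The values in \<open>nonsquare\<close> are those of the third and later iterates at
  \<gamma>, so the induction starts at the second iterate.\<close>

lemma stableI:
  assumes "irreducible F" "irreducible (poly_iter F 2)"
    and nonsquare: "\<And>k s. (crit_orbit m (Suc k))\<^sup>2 + (\<gamma> + m) \<noteq> s\<^sup>2"
  shows "stable_poly F"
proof -
  have "irreducible (poly_iter F (Suc (Suc k)))" for k
  proof (induction k)
    case 0
    show ?case using assms by (simp add: numeral_2_eq_2)
  next
    case (Suc k)
    show ?case
    proof (rule ccontr)
      assume "\<not> irreducible (poly_iter F (Suc (Suc (Suc k))))"
      from reducible_iterate_vertex_square [OF _ Suc this] obtain s where
        "poly (poly_iter F (Suc (Suc (Suc k)))) \<gamma> = s\<^sup>2" by auto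
      then show False
        using poly_iter_vertex [of "Suc (Suc k)"] nonsquare [of k s] by (simp add: algebra_simps)
    qed
  qed
  moreover have "irreducible (poly_iter F (Suc 0))" using assms by (simp add: poly_iter_1)
  ultimately show ?thesis
    unfolding stable_poly_def by (metis One_nat_def Suc_le_D not0_implies_Suc)
qed

end

section \<open>Numerical estimates, with the square root in the bound on \<open>m\<close> removed by
  squaring\<close>

lemma sqrt_bound_of_rat:
  fixes M G a b :: rat
  assumes "real_of_rat M > real_of_rat a + real_of_rat b * sqrt (real_of_rat G + 1)"
    and "G \<ge> 0" "b > 0"
  shows "M > a + b" "(M - a)\<^sup>2 > b\<^sup>2 * (G + 1)"
proof -
  let ?r = "sqrt (real_of_rat G + 1)"
  have G: "real_of_rat G \<ge> 0" and b: "real_of_rat b > 0" using assms by simp_all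
  have "1 \<le> ?r" using G by simp
  then have "real_of_rat b * 1 \<le> real_of_rat b * ?r" using b by (intro mult_left_mono) auto
  then have "real_of_rat (a + b) < real_of_rat M" using assms(1) by (simp add: of_rat_add)
  then show "M > a + b" by (simp only: of_rat_less)
  have "(real_of_rat b * ?r)\<^sup>2 < (real_of_rat (M - a))\<^sup>2"
    using assms(1) G b by (intro power_strict_mono) (auto simp: of_rat_diff)
  moreover have "(real_of_rat b * ?r)\<^sup>2 = real_of_rat (b\<^sup>2 * (G + 1))"
    using G by (simp add: power_mult_distrib of_rat_mult of_rat_power of_rat_add)
  ultimately have "real_of_rat (b\<^sup>2 * (G + 1)) < real_of_rat ((M - a)\<^sup>2)"
    by (simp add: of_rat_power)
  then show "(M - a)\<^sup>2 > b\<^sup>2 * (G + 1)" by (simp only: of_rat_less)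
qed

text \<open>Here \<open>E - \<bar>m\<bar> + 1 = (\<bar>m\<bar> - 1)\<^sup>2\<close>, so the last
  hypothesis says exactly that \<open>\<bar>\<gamma>\<bar> + \<bar>m\<bar> < E\<close>.\<close>

lemma crit_orbit_not_square_integral:
  fixes m \<gamma> s :: rat
  assumes "\<gamma> \<in> \<int>" "m \<in> \<int>" "\<gamma> + m \<noteq> 0" "\<bar>m\<bar> > 2" "(\<bar>m\<bar> - 1)\<^sup>2 > \<bar>\<gamma>\<bar> + 1"
  shows "(crit_orbit m (Suc k))\<^sup>2 + (\<gamma> + m) \<noteq> s\<^sup>2"
proof (rule crit_orbit_not_square [where D = 1 and E = "\<bar>m\<bar> * (\<bar>m\<bar> - 1)"])
  let ?E = "\<bar>m\<bar> * (\<bar>m\<bar> - 1)"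
  have "\<bar>m\<bar> * 1 \<le> ?E" using assms by (intro mult_left_mono) auto
  then have E: "?E \<ge> \<bar>m\<bar>" by simp
  then show "?E \<ge> 1" using assms by linarith
  have "\<bar>m\<bar> * 1 \<le> ?E * (?E - 1)" using assms E by (intro mult_mono) auto
  then show "\<bar>m\<bar> \<le> ?E * (?E - 1)" by simp
  have "(\<bar>m\<bar> - 1)\<^sup>2 = ?E - \<bar>m\<bar> + 1" by (simp add: power2_eq_square algebra_simps)
  then have "\<bar>\<gamma>\<bar> + \<bar>m\<bar> < ?E" using assms by linarith
  then show "\<bar>\<gamma> + m\<bar> + 1 / 1\<^sup>2 < 2 * ?E"
    using E assms abs_triangle_ineq [of \<gamma> m] by simp
qed (use assms in auto)

text \<open>\<open>D = 4\<close> clears the denominators of \<gamma> and \<open>m\<close>, and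
  \<open>E\<close> is the largest value with
  \<open>E * D\<^sup>2 \<le> \<bar>m\<bar> * (\<bar>m\<bar> - 1)\<close>.\<close>

lemma crit_orbit_not_square_half_integral:
  fixes m \<gamma> s :: rat
  assumes "4 * \<gamma> \<in> \<int>" "4 * m \<in> \<int>" "\<gamma> + m \<noteq> 0" "\<bar>\<gamma>\<bar> \<ge> 1 / 2"
    and "\<bar>m\<bar> > 9" "(\<bar>m\<bar> - 6)\<^sup>2 > 9 * (\<bar>\<gamma>\<bar> + 1)"
  shows "(crit_orbit m (Suc k))\<^sup>2 + (\<gamma> + m) \<noteq> s\<^sup>2"
proof (rule crit_orbit_not_square [where D = 4 and E = "\<bar>m\<bar> * (\<bar>m\<bar> - 1) / 16"])
  define M where "M = \<bar>m\<bar>"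
  let ?E = "\<bar>m\<bar> * (\<bar>m\<bar> - 1) / 16"
  have M9: "M > 9" using assms by (simp add: M_def)
  \<comment> \<open>As \<open>\<bar>\<gamma>\<bar> \<ge> 1 / 2\<close>, the square of
    \<open>M - 6\<close> exceeds \<open>27 / 2\<close>, which is more than
    \<open>(18 / 5)\<^sup>2\<close>.\<close>
  have M: "M > 48 / 5"
  proof (rule ccontr)
    assume "\<not> M > 48 / 5"
    then have "(M - 6)\<^sup>2 \<le> (18 / 5)\<^sup>2" using M9 by (intro power_mono) auto
    then show False using assms by (simp add: M_def power2_eq_square)
  qed
  have "M * 8 \<le> M * (M - 1)" using M by (intro mult_left_mono) auto
  then have E: "?E \<ge> M / 2" by (simp add: M_def)
  then show "?E \<ge> 1" using M by linarith
  have "M / 2 * 2 \<le> ?E * (?E - 1)" using M E by (intro mult_mono) auto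
  then show "\<bar>m\<bar> \<le> ?E * (?E - 1)" by (simp add: M_def)
  define G where "G = \<bar>\<gamma>\<bar>"
  define Q where "Q = M * M"
  have M5: "48 < 5 * M" using M by simp
  then have "48 * 48 \<le> (5 * M) * (5 * M)" by (intro mult_mono) auto
  then have "2304 \<le> 25 * Q" by (simp add: Q_def)
  moreover have "9 * (G + 1) < (M - 6)\<^sup>2" using assms by (simp add: M_def G_def)
  then have "9 * (G + 1) < Q - 12 * M + 36"
    unfolding Q_def by (simp add: power2_eq_square algebra_simps)
  \<comment> \<open>Eliminating \<open>G\<close> leaves
    \<open>49 \<le> 2 * Q / 9 + 10 * M / 3\<close> to check. At \<open>M = 9\<close> the right side
    is only 48, hence the sharper bound \<open>48 / 5\<close>.\<close>
  ultimately have "16 * G + 18 * M + 1 < 2 * Q" using M5 by (simp add: algebra_simps)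
  then have "G + M + 1 / 16 < (Q - M) / 8" by simp
  moreover have "\<bar>\<gamma> + m\<bar> \<le> G + M" unfolding G_def M_def by (rule abs_triangle_ineq)
  moreover have "2 * ?E = (Q - M) / 8" by (simp add: Q_def M_def algebra_simps)
  ultimately show "\<bar>\<gamma> + m\<bar> + 1 / 4\<^sup>2 < 2 * ?E" by simp
qed (use assms in \<open>auto simp: distrib_left\<close>)

theorem theorem4p5:
  fixes f :: "int poly" and F :: "rat poly" and \<gamma> m :: rat
  defines "F \<equiv> map_poly of_int f"
  assumes "degree f = 2" and "lead_coeff f = 1"
    and "irreducible F"
    and "F = [:-\<gamma>, 1:]\<^sup>2 + [:\<gamma> + m:]"
    and "real_of_rat \<bar>m\<bar> > 6 + 3 * sqrt (real_of_rat \<bar>\<gamma>\<bar> + 1) \<or>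
         \<gamma> \<in> \<int> \<and> real_of_rat \<bar>m\<bar> > 1 + sqrt (real_of_rat \<bar>\<gamma>\<bar> + 1)"
    and "(- real_of_rat m + sqrt (real_of_rat (poly (poly_iter F 2) \<gamma>))) / 2
           \<notin> real_of_rat ` nonzero_rat_squares"
    and "(- real_of_rat m - sqrt (real_of_rat (poly (poly_iter F 2) \<gamma>))) / 2
           \<notin> real_of_rat ` nonzero_rat_squares"
  shows "stable_poly F"
proof -
  interpret vertex_form F \<gamma> m by unfold_locales (fact assms)
  have nz: "\<gamma> + m \<noteq> 0" using vertex_value_nonzero assms by blast
  have "coeff F i \<in> \<int>" for i by (simp add: F_def coeff_map_poly)
  \<comment> \<open>The linear coefficient makes \<gamma> an integer or half an odd integer, which
    gives the two cases below.\<close>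
  from this [of 0] this [of 1] have int: "\<gamma>\<^sup>2 + \<gamma> + m \<in> \<int>" "2 * \<gamma> \<in> \<int>"
    by (simp_all add: F_coeffs)
  have sqrt1: "1 \<le> sqrt (real_of_rat \<bar>\<gamma>\<bar> + 1)" by simp
  have "(crit_orbit m (Suc k))\<^sup>2 + (\<gamma> + m) \<noteq> s\<^sup>2" for k s
  proof (cases "\<gamma> \<in> \<int>")
    case True
    have "m = (\<gamma>\<^sup>2 + \<gamma> + m) - \<gamma>\<^sup>2 - \<gamma>" by simp
    then have "m \<in> \<int>" using int True by (metis Ints_diff Ints_power)
    \<comment> \<open>Either alternative of the hypothesis on \<open>m\<close> implies this weaker
      bound.\<close>
    moreover have "real_of_rat \<bar>m\<bar> > real_of_rat 1 + real_of_rat 1 * sqrt (real_of_rat \<bar>\<gamma>\<bar> + 1)"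
      using assms(6) sqrt1 unfolding of_rat_1 by linarith
    from sqrt_bound_of_rat [OF this] have "\<bar>m\<bar> > 2" "(\<bar>m\<bar> - 1)\<^sup>2 > \<bar>\<gamma>\<bar> + 1" by auto
    ultimately show ?thesis using True nz by (intro crit_orbit_not_square_integral)
  next
    case False
    have "4 * \<gamma> = 2 * (2 * \<gamma>)" by simp
    then have g4: "4 * \<gamma> \<in> \<int>" using int by (metis Ints_mult Ints_numeral)
    have "4 * m = 4 * (\<gamma>\<^sup>2 + \<gamma> + m) - (2 * \<gamma>)\<^sup>2 - 4 * \<gamma>" by (simp add: power2_eq_square)
    then have m4: "4 * m \<in> \<int>"
      using int g4 by (metis Ints_diff Ints_power Ints_mult Ints_numeral)
    obtain j where j: "2 * \<gamma> = of_int j" using int(2) by (auto elim: Ints_cases)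
    have "j \<noteq> 0" using j False by auto
    then have "(1 :: rat) \<le> of_int \<bar>j\<bar>" by linarith
    then have "\<bar>2 * \<gamma>\<bar> \<ge> 1" unfolding j by simp
    then have half: "\<bar>\<gamma>\<bar> \<ge> 1 / 2" by (simp add: abs_mult)
    have "real_of_rat \<bar>m\<bar> > real_of_rat 6 + real_of_rat 3 * sqrt (real_of_rat \<bar>\<gamma>\<bar> + 1)"
      using assms(6) False by simp
    from sqrt_bound_of_rat [OF this] have "\<bar>m\<bar> > 9" "(\<bar>m\<bar> - 6)\<^sup>2 > 9 * (\<bar>\<gamma>\<bar> + 1)"
      by auto
    then show ?thesis using g4 m4 half nz by (intro crit_orbit_not_square_half_integral)
  qed
  with assms irreducible_second_iterate show ?thesis by (intro stableI)
qed

end
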